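(* Let $-2<a<2$ and $0<\mathcal{K}<\left(\left|\tfrac a2\right|-1\right)^2$, and consider the closed invariant curve around the origin of the defocusing McMillan octupole map on the level $\mathcal{K}^-_{\mathrm{oct}}[p,q]=\mathcal{K}$. Put $$B=\frac{1-(a/2)^2+\mathcal{K}}{\sqrt{\mathcal{K}}},\qquad \kappa=\frac{B-\sqrt{B^2-4}}{2},$$ and let $\eta_+\in(0,\mathrm{K}[\kappa]]$ be defined by $\frac{1}{\mathrm{sn}(\eta_+,\kappa)}=\frac{\sqrt{\kappa}}{\sqrt[4]{\mathcal{K}}}$. Then the action of the curve is $$J_{\mathrm{sn}}=\frac{2}{\pi}\,\frac{\mathrm{sd}^2\eta_+\,\mathrm{E}[\kappa]-\mathrm{K}[\kappa]+\mathrm{cn}^2\eta_+\,\Pi[\kappa^2\mathrm{sn}^2\eta_+,\kappa]}{\mathrm{sd}\,\eta_+\,\mathrm{nd}\,\eta_+},$$ and the rotation number of the map on the curve is $\nu=\dfrac{\eta}{4\,\mathrm{K}[\kappa]}$, where $\eta=\eta_+$ if $a>0$ and $\eta=2\,\mathrm{K}[\kappa]-\eta_+$ if $a<0$.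
   Context: The defocusing McMillan octupole map with parameter $a$ is $q'=p$, $p'=-q+\dfrac{a\,p}{1-p^2}$; it preserves $\mathcal{K}^-_{\mathrm{oct}}[p,q]=p^2-a\,pq+q^2-p^2q^2$. The action of a closed curve is the enclosed area divided by $2\pi$. The rotation number is the Poincaré rotation number of the circle homeomorphism given by restricting the map to the curve, with representative chosen in $[0,1/2]$. $\mathrm{sn},\mathrm{cn},\mathrm{dn}$ are Jacobi elliptic functions with modulus $\kappa$, $\mathrm{sd}=\mathrm{sn}/\mathrm{dn}$, $\mathrm{nd}=1/\mathrm{dn}$. Elliptic integrals with modulus $\kappa$: $\mathrm{K}[\kappa]=\int_0^{\pi/2}\frac{d\theta}{\sqrt{1-\kappa^2\sin^2\theta}}$, $\mathrm{E}[\kappa]=\int_0^{\pi/2}\sqrt{1-\kappa^2\sin^2\theta}\,d\theta$, $\Pi[n,\kappa]=\int_0^{\pi/2}\frac{d\theta}{(1-n\sin^2\theta)\sqrt{1-\kappa^2\sin^2\theta}}$. *)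

theory Defs
  imports "HOL-Analysis.Analysis"
begin

definition ellK :: "real \<Rightarrow> real" where
  "ellK \<kappa> = integral {0..pi/2} (\<lambda>\<theta>. 1 / sqrt (1 - \<kappa>\<^sup>2 * (sin \<theta>)\<^sup>2))"

definition ellE :: "real \<Rightarrow> real" where
  "ellE \<kappa> = integral {0..pi/2} (\<lambda>\<theta>. sqrt (1 - \<kappa>\<^sup>2 * (sin \<theta>)\<^sup>2))"

definition ellPi :: "real \<Rightarrow> real \<Rightarrow> real" where
  "ellPi n \<kappa> = integral {0..pi/2}
     (\<lambda>\<theta>. 1 / ((1 - n * (sin \<theta>)\<^sup>2) * sqrt (1 - \<kappa>\<^sup>2 * (sin \<theta>)\<^sup>2)))"

text \<open>The incomplete integral of the first kind is oriented (negative for \<open>\<phi> < 0\<close>), so that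
  for \<open>0 \<le> \<kappa> < 1\<close> it is a bijection of the real line, whose inverse is the amplitude.\<close>

definition ellF :: "real \<Rightarrow> real \<Rightarrow> real" where
  "ellF \<phi> \<kappa> = (LBINT \<theta>=0..\<phi>. 1 / sqrt (1 - \<kappa>\<^sup>2 * (sin \<theta>)\<^sup>2))"

definition jam :: "real \<Rightarrow> real \<Rightarrow> real" where
  "jam u \<kappa> = (THE \<phi>. ellF \<phi> \<kappa> = u)"

definition jsn :: "real \<Rightarrow> real \<Rightarrow> real" where
  "jsn u \<kappa> = sin (jam u \<kappa>)"

definition jcn :: "real \<Rightarrow> real \<Rightarrow> real" where
  "jcn u \<kappa> = cos (jam u \<kappa>)"

definition jdn :: "real \<Rightarrow> real \<Rightarrow> real" where
  "jdn u \<kappa> = sqrt (1 - \<kappa>\<^sup>2 * (jsn u \<kappa>)\<^sup>2)"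

definition jsd :: "real \<Rightarrow> real \<Rightarrow> real" where
  "jsd u \<kappa> = jsn u \<kappa> / jdn u \<kappa>"

definition jnd :: "real \<Rightarrow> real \<Rightarrow> real" where
  "jnd u \<kappa> = 1 / jdn u \<kappa>"

text \<open>Phase-space points are pairs \<open>(q, p)\<close>. On the lines \<open>p = \<plusminus>1\<close>, where the map is undefined,
  division by zero gives a dummy value; these lines do not meet the closed curves below.\<close>

definition oct_map :: "real \<Rightarrow> real \<times> real \<Rightarrow> real \<times> real" where
  "oct_map a = (\<lambda>(q, p). (p, - q + a * p / (1 - p\<^sup>2)))"

definition oct_invariant :: "real \<Rightarrow> real \<times> real \<Rightarrow> real" where
  "oct_invariant a = (\<lambda>(q, p). p\<^sup>2 - a * p * q + q\<^sup>2 - p\<^sup>2 * q\<^sup>2)"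

definition closed_curve :: "(real \<times> real) set \<Rightarrow> bool" where
  "closed_curve C \<longleftrightarrow>
     (\<exists>\<gamma>. simple_path \<gamma> \<and> pathfinish \<gamma> = pathstart \<gamma> \<and> path_image \<gamma> = C)"

text \<open>The level sets considered also have unbounded components; the closed invariant curve around
  the origin is the only simple closed curve in the level set with the origin in its interior.\<close>

definition oct_curve :: "real \<Rightarrow> real \<Rightarrow> (real \<times> real) set \<Rightarrow> bool" where
  "oct_curve a k C \<longleftrightarrow>
     closed_curve C \<and> (\<forall>z\<in>C. oct_invariant a z = k) \<and> oct_map a ` C = C \<and> (0, 0) \<in> inside C"

definition action :: "(real \<times> real) set \<Rightarrow> real" where
  "action C = measure lebesgue (inside C) / (2 * pi)"

text \<open>\<open>h\<close> identifies \<open>C\<close> with the circle of reals modulo 1.\<close>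

definition circle_param :: "(real \<Rightarrow> 'a::topological_space) \<Rightarrow> 'a set \<Rightarrow> bool" where
  "circle_param h C \<longleftrightarrow>
     continuous_on UNIV h \<and> (\<forall>t. h (t + 1) = h t) \<and> inj_on h {0..<1} \<and> range h = C"

definition circle_lift ::
    "(real \<Rightarrow> 'a::topological_space) \<Rightarrow> ('a \<Rightarrow> 'a) \<Rightarrow> (real \<Rightarrow> real) \<Rightarrow> bool" where
  "circle_lift h f G \<longleftrightarrow>
     continuous_on UNIV G \<and> strict_mono G \<and> (\<forall>t. G (t + 1) = G t + 1) \<and> (\<forall>t. h (G t) = f (h t))"

text \<open>Changing the lift shifts its translation number by an integer, and reversing the orientation
  of the curve negates it; exactly one of the resulting numbers lies in \<open>[0, 1/2]\<close>. The choice
  of \<open>h\<close> and \<open>G\<close> selects that representative.\<close>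

definition has_rotation_number ::
    "('a::topological_space \<Rightarrow> 'a) \<Rightarrow> 'a set \<Rightarrow> real \<Rightarrow> bool" where
  "has_rotation_number f C \<nu> \<longleftrightarrow>
     0 \<le> \<nu> \<and> \<nu> \<le> 1/2 \<and>
     (\<exists>h G. circle_param h C \<and> circle_lift h f G \<and>
        (\<forall>t. (\<lambda>n. ((G ^^ n) t - t) / real n) \<longlonglongrightarrow> \<nu>))"

end

theory Submission
  imports Defs
begin

text \<open>Put \<open>m = \<kappa> sn \<eta>\<close>, with \<open>\<eta>\<close> the shift of the theorem. The parameters satisfy \<open>k = (m sn \<eta>)\<^sup>2\<close>
  and \<open>a = 2 cn \<eta> dn \<eta>\<close>, so the addition theorem for \<open>sn\<close> shows that
  \<open>u \<mapsto> (m sn (u - \<eta>), m sn u)\<close> parametrizes the curve and that the map acts as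
  \<open>u \<mapsto> u + \<eta>\<close>; the rotation number is \<open>\<eta>\<close> over the period \<open>4 K\<close>. A curve satisfying the hypotheses
  stays in the strip \<open>\<bar>p\<bar> \<le> m\<close> and meets every ray from the origin, whereas the part of the level set
  in this strip meets each ray only once; hence they coincide. The enclosed area is the integral over
  \<open>p = m sin \<theta>\<close> of the length of the horizontal slices, which partial fractions reduce to the three
  complete elliptic integrals.\<close>

section \<open>Jacobi elliptic functions\<close>

locale elliptic_modulus =
  fixes \<kappa> :: real
  assumes modulus_less_1: "\<kappa>\<^sup>2 < 1"
begin

section \<open>The incomplete integral of the first kind\<close>

definition \<Delta> :: "real \<Rightarrow> real" where
  "\<Delta> \<phi> = sqrt (1 - \<kappa>\<^sup>2 * (sin \<phi>)\<^sup>2)"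

lemma \<Delta>_arg_pos: "0 < 1 - \<kappa>\<^sup>2 * (sin \<phi>)\<^sup>2"
proof -
  have "(sin \<phi>)\<^sup>2 \<le> 1" by (simp add: abs_square_le_1)
  then have "\<kappa>\<^sup>2 * (sin \<phi>)\<^sup>2 \<le> \<kappa>\<^sup>2" by (simp add: mult_left_le)
  with modulus_less_1 show ?thesis by linarith
qed

lemma \<Delta>_pos: "0 < \<Delta> \<phi>" and \<Delta>_squared: "(\<Delta> \<phi>)\<^sup>2 = 1 - \<kappa>\<^sup>2 * (sin \<phi>)\<^sup>2"
  using \<Delta>_arg_pos[of \<phi>] by (auto simp: \<Delta>_def)

lemma \<Delta>_le_1: "\<Delta> \<phi> \<le> 1"
  by (simp add: \<Delta>_def)

lemma continuous_\<Delta>: "continuous_on A \<Delta>"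
  unfolding \<Delta>_def by (intro continuous_intros)

lemma ellF_0: "ellF 0 \<kappa> = 0"
  by (simp add: ellF_def flip: zero_ereal_def)

lemma DERIV_ellF: "((\<lambda>\<phi>. ellF \<phi> \<kappa>) has_real_derivative 1 / \<Delta> \<phi>) (at \<phi>)"
proof -
  \<comment> \<open>The interval from \<open>-?b\<close> to \<open>?b\<close> contains the base
    point 0 and has \<open>\<phi>\<close> in its interior, so the derivative within it is the full
    derivative.\<close>
  let ?b = "\<bar>\<phi>\<bar> + 1"
  have "continuous_on {-?b..?b} (\<lambda>\<theta>. 1 / \<Delta> \<theta>)"
    using \<Delta>_pos by (intro continuous_intros continuous_\<Delta>) (auto simp: less_le)
  then have "((\<lambda>u. LBINT y=0..u. 1 / \<Delta> y) has_vector_derivative 1 / \<Delta> \<phi>) (at \<phi> within {-?b..?b})"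
    using interval_integral_FTC2[of "-?b" 0 ?b "\<lambda>\<theta>. 1 / \<Delta> \<theta>" \<phi>] by (simp flip: zero_ereal_def)
  moreover have "at \<phi> within {-?b..?b} = at \<phi>"
    by (rule at_within_interior) (auto simp: abs_if)
  ultimately show ?thesis
    by (simp add: ellF_def \<Delta>_def has_real_derivative_iff_has_vector_derivative)
qed

lemma ellF_strict_mono: "strict_mono (\<lambda>\<phi>. ellF \<phi> \<kappa>)"
proof (rule strict_monoI)
  fix x y :: real
  assume "x < y"
  then show "ellF x \<kappa> < ellF y \<kappa>"
    by (rule DERIV_pos_imp_increasing) (blast intro: DERIV_ellF divide_pos_pos \<Delta>_pos zero_less_one)
qed

text \<open>The integrand \<open>1 / \<Delta>\<close> is at least 1. This growth bound supplies the
  bracketing values for surjectivity.\<close>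

lemma ellF_diff_ge:
  assumes "x \<le> y"
  shows "y - x \<le> ellF y \<kappa> - ellF x \<kappa>"
proof -
  have "ellF x \<kappa> - x \<le> ellF y \<kappa> - y"
  proof (rule DERIV_nonneg_imp_nondecreasing[OF assms])
    fix t
    have "((\<lambda>\<phi>. ellF \<phi> \<kappa> - \<phi>) has_real_derivative 1 / \<Delta> t - 1) (at t)"
      by (intro derivative_intros DERIV_ellF)
    moreover have "0 \<le> 1 / \<Delta> t - 1"
      using \<Delta>_pos[of t] \<Delta>_le_1[of t] by simp
    ultimately show "\<exists>y. ((\<lambda>\<phi>. ellF \<phi> \<kappa> - \<phi>) has_real_derivative y) (at t) \<and> 0 \<le> y"
      by blast
  qed
  then show ?thesis by simp
qed

lemma isCont_ellF: "isCont (\<lambda>\<phi>. ellF \<phi> \<kappa>) x"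
  using DERIV_ellF DERIV_isCont by blast

lemma ellF_surj: "\<exists>\<phi>. ellF \<phi> \<kappa> = u"
proof -
  have "\<exists>\<phi>. -\<bar>u\<bar> \<le> \<phi> \<and> \<phi> \<le> \<bar>u\<bar> \<and> ellF \<phi> \<kappa> = u"
    using ellF_diff_ge[of 0 "\<bar>u\<bar>"] ellF_diff_ge[of "-\<bar>u\<bar>" 0] ellF_0 isCont_ellF
    by (intro IVT) auto
  then show ?thesis by blast
qed

lemma ellF_eq_iff: "ellF x \<kappa> = ellF y \<kappa> \<longleftrightarrow> x = y"
  using ellF_strict_mono strict_mono_eq by blast

section \<open>The amplitude as inverse function\<close>

lemma jam_ellF [simp]: "jam (ellF \<phi> \<kappa>) \<kappa> = \<phi>"
  by (simp add: jam_def ellF_eq_iff)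

lemma ellF_jam [simp]: "ellF (jam u \<kappa>) \<kappa> = u"
  using ellF_surj[of u] by auto

lemma jam_eqI: "ellF \<phi> \<kappa> = u \<Longrightarrow> jam u \<kappa> = \<phi>"
  by auto

lemma jam_0: "jam 0 \<kappa> = 0"
  by (intro jam_eqI ellF_0)

lemma jam_strict_mono: "strict_mono (\<lambda>u. jam u \<kappa>)"
proof (rule strict_monoI)
  fix x y :: real
  assume "x < y"
  then show "jam x \<kappa> < jam y \<kappa>"
    using strict_mono_less[OF ellF_strict_mono, of "jam x \<kappa>" "jam y \<kappa>"] by simp
qed

lemma isCont_jam: "isCont (\<lambda>u. jam u \<kappa>) u"
  using isCont_inverse_function[of 1 "jam u \<kappa>" "\<lambda>u. jam u \<kappa>" "\<lambda>\<phi>. ellF \<phi> \<kappa>"] isCont_ellF by simp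

lemma DERIV_jam: "((\<lambda>u. jam u \<kappa>) has_real_derivative \<Delta> (jam u \<kappa>)) (at u)"
  using DERIV_inverse_function[of "\<lambda>\<phi>. ellF \<phi> \<kappa>" "1 / \<Delta> (jam u \<kappa>)" "\<lambda>u. jam u \<kappa>" u "u - 1" "u + 1"]
    DERIV_ellF isCont_jam \<Delta>_pos[of "jam u \<kappa>"] by simp

section \<open>The complete integral, reflections and the period\<close>

lemma ellF_half_pi: "ellF (pi / 2) \<kappa> = ellK \<kappa>"
proof -
  have "((\<lambda>\<theta>. 1 / \<Delta> \<theta>) has_integral (ellF (pi / 2) \<kappa> - ellF 0 \<kappa>)) {0..pi / 2}"
    using DERIV_ellF
    by (intro fundamental_theorem_of_calculus)
      (auto simp: has_real_derivative_iff_has_vector_derivative intro: has_vector_derivative_at_within)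
  then show ?thesis
    by (simp add: ellK_def \<Delta>_def integral_unique ellF_0)
qed

lemma ellK_pos: "0 < ellK \<kappa>"
  using strict_monoD[OF ellF_strict_mono, of 0 "pi / 2"] ellF_half_pi ellF_0 by simp

lemma jam_ellK: "jam (ellK \<kappa>) \<kappa> = pi / 2"
  by (intro jam_eqI ellF_half_pi)

text \<open>Since \<open>\<Delta>\<close> is symmetric about \<open>pi / 2\<close>, the derivatives
  of the two \<open>ellF\<close> terms cancel; the constant sum is read off at the fixed point
  \<open>pi / 2\<close>.\<close>

lemma ellF_pi_minus: "ellF (pi - \<phi>) \<kappa> = 2 * ellK \<kappa> - ellF \<phi> \<kappa>"
proof -
  have "((\<lambda>\<phi>. ellF (pi - \<phi>) \<kappa> + ellF \<phi> \<kappa>) has_real_derivative 0) (at t)" for t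
  proof -
    have "\<Delta> (pi - t) = \<Delta> t" by (simp add: \<Delta>_def)
    then show ?thesis
      by (auto intro!: derivative_eq_intros DERIV_ellF DERIV_chain'[where g = "\<lambda>\<phi>. ellF \<phi> \<kappa>"])
  qed
  then have "ellF (pi - \<phi>) \<kappa> + ellF \<phi> \<kappa> = ellF (pi - pi / 2) \<kappa> + ellF (pi / 2) \<kappa>"
    by (intro DERIV_isconst_all) blast
  moreover have "pi - pi / 2 = pi / 2"
    by simp
  ultimately show ?thesis
    using ellF_half_pi by simp
qed

lemma ellF_minus: "ellF (- \<phi>) \<kappa> = - ellF \<phi> \<kappa>"
proof -
  have "((\<lambda>\<phi>. ellF (- \<phi>) \<kappa> + ellF \<phi> \<kappa>) has_real_derivative 0) (at t)" for t
  proof -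
    have "\<Delta> (- t) = \<Delta> t" by (simp add: \<Delta>_def)
    then show ?thesis
      by (auto intro!: derivative_eq_intros DERIV_ellF DERIV_chain'[where g = "\<lambda>\<phi>. ellF \<phi> \<kappa>"])
  qed
  then have "ellF (- \<phi>) \<kappa> + ellF \<phi> \<kappa> = ellF (- 0) \<kappa> + ellF 0 \<kappa>"
    by (intro DERIV_isconst_all) blast
  then show ?thesis
    by (simp add: ellF_0)
qed

text \<open>Reflecting at 0 and then at \<open>pi / 2\<close> translates by \<open>pi\<close> and
  adds \<open>2 * ellK \<kappa>\<close>; this is done twice.\<close>

lemma ellF_plus_2pi: "ellF (\<phi> + 2 * pi) \<kappa> = ellF \<phi> \<kappa> + 4 * ellK \<kappa>"
  using ellF_pi_minus[of "- (\<phi> + pi)"] ellF_minus[of "\<phi> + pi"] ellF_pi_minus[of "-\<phi>"] ellF_minus[of \<phi>]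
  by (simp add: algebra_simps)

lemma jam_reflect: "jam (2 * ellK \<kappa> - u) \<kappa> = pi - jam u \<kappa>"
  by (intro jam_eqI) (simp add: ellF_pi_minus)

lemma jam_minus: "jam (- u) \<kappa> = - jam u \<kappa>"
  by (intro jam_eqI) (simp add: ellF_minus)

lemma jam_period: "jam (u + 4 * ellK \<kappa>) \<kappa> = jam u \<kappa> + 2 * pi"
  by (intro jam_eqI) (simp add: ellF_plus_2pi)

section \<open>Identities and derivatives of sn, cn and dn\<close>

lemma jdn_eq_\<Delta>: "jdn u \<kappa> = \<Delta> (jam u \<kappa>)"
  by (simp add: jdn_def jsn_def \<Delta>_def)

lemma jdn_pos: "0 < jdn u \<kappa>"
  by (simp add: jdn_eq_\<Delta> \<Delta>_pos)

lemma jcn_squared: "(jcn u \<kappa>)\<^sup>2 = 1 - (jsn u \<kappa>)\<^sup>2"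
  by (simp add: jcn_def jsn_def cos_squared_eq)

lemma jdn_squared: "(jdn u \<kappa>)\<^sup>2 = 1 - \<kappa>\<^sup>2 * (jsn u \<kappa>)\<^sup>2"
  by (simp add: jdn_eq_\<Delta> \<Delta>_squared jsn_def)

lemma jsn_squared_le_1: "(jsn u \<kappa>)\<^sup>2 \<le> 1"
  by (simp add: jsn_def abs_square_le_1)

lemma jsn_minus: "jsn (- u) \<kappa> = - jsn u \<kappa>"
  and jcn_minus: "jcn (- u) \<kappa> = jcn u \<kappa>"
  and jdn_minus: "jdn (- u) \<kappa> = jdn u \<kappa>"
  by (simp_all add: jsn_def jcn_def jdn_def jam_minus)

lemma jsn_period: "jsn (u + 4 * ellK \<kappa>) \<kappa> = jsn u \<kappa>"
  by (simp add: jsn_def jam_period)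

lemma jsn_reflect: "jsn (2 * ellK \<kappa> - u) \<kappa> = jsn u \<kappa>"
  and jcn_reflect: "jcn (2 * ellK \<kappa> - u) \<kappa> = - jcn u \<kappa>"
  and jdn_reflect: "jdn (2 * ellK \<kappa> - u) \<kappa> = jdn u \<kappa>"
  by (simp_all add: jsn_def jcn_def jdn_def jam_reflect)

lemma DERIV_jsn: "((\<lambda>u. jsn u \<kappa>) has_real_derivative jcn u \<kappa> * jdn u \<kappa>) (at u)"
  unfolding jsn_def jcn_def jdn_eq_\<Delta> by (auto intro!: derivative_eq_intros DERIV_jam)

lemma DERIV_jcn: "((\<lambda>u. jcn u \<kappa>) has_real_derivative - jsn u \<kappa> * jdn u \<kappa>) (at u)"
  unfolding jsn_def jcn_def jdn_eq_\<Delta> by (auto intro!: derivative_eq_intros DERIV_jam)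

lemma DERIV_jdn: "((\<lambda>u. jdn u \<kappa>) has_real_derivative - \<kappa>\<^sup>2 * jsn u \<kappa> * jcn u \<kappa>) (at u)"
proof -
  have pos: "0 < 1 - \<kappa>\<^sup>2 * (jsn u \<kappa>)\<^sup>2"
    using \<Delta>_arg_pos by (simp add: jsn_def)
  have "((\<lambda>u. sqrt (1 - \<kappa>\<^sup>2 * (jsn u \<kappa>)\<^sup>2)) has_real_derivative
      - (\<kappa>\<^sup>2 * (2 * jsn u \<kappa> * (jcn u \<kappa> * jdn u \<kappa>))) / (2 * jdn u \<kappa>)) (at u)"
    using pos unfolding jdn_def[of u]
    by (auto intro!: derivative_eq_intros DERIV_jsn[unfolded jdn_def] simp: field_simps)
  then show ?thesis
    using jdn_pos[of u] unfolding jdn_def by (simp add: field_simps)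
qed

section \<open>The addition theorem for sn\<close>

lemma jsn_add_denom_pos: "0 < 1 - \<kappa>\<^sup>2 * (jsn u \<kappa>)\<^sup>2 * (jsn v \<kappa>)\<^sup>2"
proof -
  have "\<kappa>\<^sup>2 * (jsn u \<kappa>)\<^sup>2 * (jsn v \<kappa>)\<^sup>2 \<le> \<kappa>\<^sup>2 * 1 * 1"
    by (intro mult_mono jsn_squared_le_1) (auto intro: jsn_squared_le_1)
  with modulus_less_1 show ?thesis by simp
qed

text \<open>The right-hand side is constant when \<open>u\<close> and \<open>v\<close> vary with \<open>u + v\<close> fixed.\<close>

theorem jsn_add:
  "jsn (u + v) \<kappa> = (jsn u \<kappa> * jcn v \<kappa> * jdn v \<kappa> + jsn v \<kappa> * jcn u \<kappa> * jdn u \<kappa>)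
     / (1 - \<kappa>\<^sup>2 * (jsn u \<kappa>)\<^sup>2 * (jsn v \<kappa>)\<^sup>2)"
proof -
  define c where "c = u + v"
  define num where "num t = jsn t \<kappa> * jcn (c - t) \<kappa> * jdn (c - t) \<kappa> + jsn (c - t) \<kappa> * jcn t \<kappa> * jdn t \<kappa>" for t
  define den where "den t = 1 - \<kappa>\<^sup>2 * (jsn t \<kappa>)\<^sup>2 * (jsn (c - t) \<kappa>)\<^sup>2" for t
  have "((\<lambda>t. num t / den t) has_real_derivative 0) (at t)" for t
  proof -
    let ?s = "jsn t \<kappa>" and ?c = "jcn t \<kappa>" and ?d = "jdn t \<kappa>"
    let ?s' = "jsn (c - t) \<kappa>" and ?c' = "jcn (c - t) \<kappa>" and ?d' = "jdn (c - t) \<kappa>"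
    have D: "((\<lambda>t. jsn (c - t) \<kappa>) has_real_derivative - ?c' * ?d') (at t)"
      "((\<lambda>t. jcn (c - t) \<kappa>) has_real_derivative ?s' * ?d') (at t)"
      "((\<lambda>t. jdn (c - t) \<kappa>) has_real_derivative \<kappa>\<^sup>2 * ?s' * ?c') (at t)"
      by (rule DERIV_chain2[OF DERIV_jsn, THEN DERIV_cong], (auto intro!: derivative_eq_intros)[2])
        (rule DERIV_chain2[OF DERIV_jcn, THEN DERIV_cong], (auto intro!: derivative_eq_intros)[2],
         rule DERIV_chain2[OF DERIV_jdn, THEN DERIV_cong], (auto intro!: derivative_eq_intros)[2])
    note sq = jcn_squared[of t] jcn_squared[of "c - t"] jdn_squared[of t] jdn_squared[of "c - t"]
    \<comment> \<open>The two products of all four cn and dn factors, which arise from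
      differentiating the sn factors, cancel.\<close>
    have "(num has_real_derivative
        ?s * ?s' * (?d'\<^sup>2 - ?d\<^sup>2 + \<kappa>\<^sup>2 * (?c'\<^sup>2 - ?c\<^sup>2))) (at t)"
      unfolding num_def
      by (auto intro!: derivative_eq_intros D DERIV_jsn DERIV_jcn DERIV_jdn
          simp: algebra_simps power2_eq_square)
    then have num': "(num has_real_derivative 2 * \<kappa>\<^sup>2 * ?s * ?s' * (?s\<^sup>2 - ?s'\<^sup>2)) (at t)"
      unfolding sq by (simp add: algebra_simps)
    have den': "(den has_real_derivative
        - 2 * \<kappa>\<^sup>2 * ?s * ?s' * (?s' * ?c * ?d - ?s * ?c' * ?d')) (at t)"
      unfolding den_def
      by (auto intro!: derivative_eq_intros D DERIV_jsn simp: algebra_simps power2_eq_square)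
    \<comment> \<open>This is the numerator in the quotient rule. \<open>num t\<close> times the
      last bracket is a difference of two squares, so cn and dn occur only squared and a polynomial
      identity in the two sn values remains.\<close>
    have "2 * \<kappa>\<^sup>2 * ?s * ?s' * (?s\<^sup>2 - ?s'\<^sup>2) * den t
        - num t * (- 2 * \<kappa>\<^sup>2 * ?s * ?s' * (?s' * ?c * ?d - ?s * ?c' * ?d'))
      = 2 * \<kappa>\<^sup>2 * ?s * ?s' * ((?s\<^sup>2 - ?s'\<^sup>2) * (1 - \<kappa>\<^sup>2 * ?s\<^sup>2 * ?s'\<^sup>2)
          + ?s'\<^sup>2 * ?c\<^sup>2 * ?d\<^sup>2 - ?s\<^sup>2 * ?c'\<^sup>2 * ?d'\<^sup>2)"
      unfolding num_def den_def by algebra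
    also have "\<dots> = 0"
      unfolding sq by algebra
    finally have "2 * \<kappa>\<^sup>2 * ?s * ?s' * (?s\<^sup>2 - ?s'\<^sup>2) * den t
        - num t * (- 2 * \<kappa>\<^sup>2 * ?s * ?s' * (?s' * ?c * ?d - ?s * ?c' * ?d')) = 0" .
    moreover have "den t \<noteq> 0"
      using jsn_add_denom_pos[of t "c - t"] by (simp add: den_def)
    ultimately show ?thesis
      using DERIV_divide[OF num' den'] by simp
  qed
  then have "num u / den u = num 0 / den 0"
    by (intro DERIV_isconst_all) blast
  also have "\<dots> = jsn c \<kappa>"
    by (simp add: num_def den_def jsn_def jcn_def jdn_def jam_0)
  finally show ?thesis
    by (simp add: num_def den_def c_def)
qed

lemma jsn_diff:
  "jsn (u - v) \<kappa> = (jsn u \<kappa> * jcn v \<kappa> * jdn v \<kappa> - jsn v \<kappa> * jcn u \<kappa> * jdn u \<kappa>)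
     / (1 - \<kappa>\<^sup>2 * (jsn u \<kappa>)\<^sup>2 * (jsn v \<kappa>)\<^sup>2)"
  using jsn_add[of u "- v"] by (simp add: jsn_minus jcn_minus jdn_minus)

end

section \<open>The closed component of a level set\<close>

text \<open>The inside of a compact set is open and bounded, so the ray must reach its frontier,
  which lies in the set.\<close>

lemma ray_from_inside_meets:
  fixes S :: "'a::euclidean_space set"
  assumes "compact S" and "x \<in> inside S" and "l \<noteq> 0"
  obtains t where "0 < t" and "x + t *\<^sub>R l \<in> S"
proof -
  have "x \<in> interior (inside S)"
    using assms by (simp add: compact_imp_closed interior_open open_inside)
  then obtain t where "0 < t" "x + t *\<^sub>R l \<in> frontier (inside S)"
    using ray_to_frontier[of "inside S" x l] assms by (metis bounded_inside compact_imp_bounded)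
  moreover have "frontier (inside S) \<subseteq> S"
    using assms by (simp add: compact_imp_closed frontier_inside_subset)
  ultimately show ?thesis
    using that by blast
qed

text \<open>\<open>U\<close> is open and closed relative to the complement of \<open>S\<close>, so
  the component of each of its points stays in \<open>U\<close> and is bounded.\<close>

lemma bounded_open_subset_inside:
  fixes S :: "'a::real_normed_vector set"
  assumes "open U" and "bounded U" and "closed (U \<union> S)" and "U \<inter> S = {}"
  shows "U \<subseteq> inside S"
proof
  fix x
  assume x: "x \<in> U"
  let ?T = "connected_component_set (- S) x"
  have "?T \<subseteq> - S" by (rule connected_component_subset)
  moreover have "x \<in> ?T" using x assms by auto
  moreover have "U \<inter> ?T = {} \<or> - (U \<union> S) \<inter> ?T = {}"
  proof (rule connectedD[OF connected_connected_component \<open>open U\<close>])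
    show "open (- (U \<union> S))"
      using assms(3) by (rule open_Compl)
  qed (use \<open>?T \<subseteq> - S\<close> in blast)+
  ultimately have "?T \<subseteq> U"
    using x by blast
  then show "x \<in> inside S"
    using x assms bounded_subset by (auto simp: inside_def)
qed

text \<open>The parameters \<open>m < s\<close> are the positive zeros of the discriminant of the equation
  \<open>oct_invariant a (q, p) = m\<^sup>2 * s\<^sup>2\<close>, which is quadratic in \<open>q\<close>.\<close>

locale octupole_oval =
  fixes a m s :: real
  assumes m_pos: "0 < m" and m_less_s: "m < s" and s_le_1: "s \<le> 1"
    and half_a_squared: "(a / 2)\<^sup>2 = (1 - m\<^sup>2) * (1 - s\<^sup>2)"
begin

section \<open>The oval and the region it bounds\<close>

text \<open>The strip separates this part of the level set from the remaining points, which satisfy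
  \<open>s \<le> \<bar>p\<bar>\<close> by \<open>level_set_gap\<close>.\<close>

definition oval :: "(real \<times> real) set" where
  "oval = {z. oct_invariant a z = m\<^sup>2 * s\<^sup>2 \<and> \<bar>snd z\<bar> \<le> m}"

definition oval_interior :: "(real \<times> real) set" where
  "oval_interior = {z. oct_invariant a z < m\<^sup>2 * s\<^sup>2 \<and> \<bar>snd z\<bar> < m}"

text \<open>Multiplying by \<open>1 - p\<^sup>2\<close> and completing the square in
  \<open>q\<close> leaves a polynomial in \<open>p\<^sup>2\<close>; \<open>half_a_squared\<close> is
  exactly what makes it factor.\<close>

lemma oct_invariant_discriminant:
  "(1 - p\<^sup>2) * (m\<^sup>2 * s\<^sup>2 - oct_invariant a (q, p))
    = (m\<^sup>2 - p\<^sup>2) * (s\<^sup>2 - p\<^sup>2) - (q * (1 - p\<^sup>2) - a / 2 * p)\<^sup>2"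
proof -
  have "a\<^sup>2 = 4 * ((1 - m\<^sup>2) * (1 - s\<^sup>2))"
    using half_a_squared by (simp add: power2_eq_square)
  then show ?thesis
    unfolding oct_invariant_def by simp algebra
qed

lemma abs_le_m_imp:
  assumes "\<bar>p\<bar> \<le> m"
  shows "p\<^sup>2 \<le> m\<^sup>2" and "p\<^sup>2 < s\<^sup>2" and "0 < 1 - p\<^sup>2"
proof -
  show 1: "p\<^sup>2 \<le> m\<^sup>2"
    using assms by (simp add: abs_le_square_iff[symmetric])
  have "m\<^sup>2 < s\<^sup>2" "s\<^sup>2 \<le> 1"
    using m_pos m_less_s s_le_1 by (auto simp: power_strict_mono power_le_one)
  with 1 show "p\<^sup>2 < s\<^sup>2" "0 < 1 - p\<^sup>2"
    by linarith+
qed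

lemma in_oval_iff:
  "(q, p) \<in> oval \<longleftrightarrow> \<bar>p\<bar> \<le> m \<and> (q * (1 - p\<^sup>2) - a / 2 * p)\<^sup>2 = (m\<^sup>2 - p\<^sup>2) * (s\<^sup>2 - p\<^sup>2)"
proof (cases "\<bar>p\<bar> \<le> m")
  case True
  then show ?thesis
    using oct_invariant_discriminant[of p q] abs_le_m_imp(3)[OF True]
    by (auto simp: oval_def)
qed (simp add: oval_def)

lemma in_oval_interior_iff:
  "(q, p) \<in> oval_interior \<longleftrightarrow> \<bar>p\<bar> \<le> m \<and> (q * (1 - p\<^sup>2) - a / 2 * p)\<^sup>2 < (m\<^sup>2 - p\<^sup>2) * (s\<^sup>2 - p\<^sup>2)"
proof (cases "\<bar>p\<bar> \<le> m")
  case True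
  have "oct_invariant a (q, p) < m\<^sup>2 * s\<^sup>2
      \<longleftrightarrow> 0 < (1 - p\<^sup>2) * (m\<^sup>2 * s\<^sup>2 - oct_invariant a (q, p))"
    using abs_le_m_imp(3)[OF True] by (simp add: zero_less_mult_iff)
  then have iff: "oct_invariant a (q, p) < m\<^sup>2 * s\<^sup>2
      \<longleftrightarrow> (q * (1 - p\<^sup>2) - a / 2 * p)\<^sup>2 < (m\<^sup>2 - p\<^sup>2) * (s\<^sup>2 - p\<^sup>2)"
    unfolding oct_invariant_discriminant by simp
  \<comment> \<open>On the lines \<open>\<bar>p\<bar> = m\<close> the discriminant vanishes and no
    square lies below it, which reconciles the weak bound here with the strict one in
    \<open>oval_interior\<close>.\<close>
  have "p\<^sup>2 = m\<^sup>2" if "\<bar>p\<bar> = m"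
    using that by (metis power2_abs)
  then have "\<not> (q * (1 - p\<^sup>2) - a / 2 * p)\<^sup>2 < (m\<^sup>2 - p\<^sup>2) * (s\<^sup>2 - p\<^sup>2)" if "\<bar>p\<bar> = m"
    using that by (simp add: not_less)
  with True iff show ?thesis
    by (auto simp: oval_interior_def less_le[of "\<bar>p\<bar>"])
qed (simp add: oval_interior_def)

text \<open>Closedness can be read off from the weak inequalities. A point with
  \<open>\<bar>p\<bar> = m\<close> at or below the level lies on the level, because there the
  discriminant is 0.\<close>

lemma oval_closure_eq:
  "oval_interior \<union> oval = {z. oct_invariant a z \<le> m\<^sup>2 * s\<^sup>2 \<and> \<bar>snd z\<bar> \<le> m}" (is "_ = ?R")
proof -
  have "z \<in> oval_interior \<union> oval \<longleftrightarrow> z \<in> ?R" for z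
  proof (cases z)
    case (Pair q p)
    show ?thesis
    proof (cases "\<bar>p\<bar> \<le> m")
      case True
      then have "oct_invariant a (q, p) \<le> m\<^sup>2 * s\<^sup>2
          \<longleftrightarrow> 0 \<le> (1 - p\<^sup>2) * (m\<^sup>2 * s\<^sup>2 - oct_invariant a (q, p))"
        using abs_le_m_imp(3)[OF True] by (simp add: zero_le_mult_iff)
      then show ?thesis
        unfolding oct_invariant_discriminant
        using True by (auto simp: Pair in_oval_iff in_oval_interior_iff)
    qed (auto simp: Pair oval_def oval_interior_def)
  qed
  then show ?thesis by blast
qed

lemma continuous_oct_invariant: "continuous_on A (oct_invariant a)"
  unfolding oct_invariant_def case_prod_beta by (intro continuous_intros)

lemma open_oval_interior: "open oval_interior"
  unfolding oval_interior_def
  by (intro open_Collect_conj open_Collect_less continuous_intros continuous_oct_invariant)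

lemma closed_oval: "closed oval"
  unfolding oval_def
  by (intro closed_Collect_conj closed_Collect_eq closed_Collect_le continuous_intros continuous_oct_invariant)

lemma closed_oval_closure: "closed (oval_interior \<union> oval)"
  unfolding oval_closure_eq
  by (intro closed_Collect_conj closed_Collect_le continuous_intros continuous_oct_invariant)

text \<open>Cauchy--Schwarz for the vectors \<open>(\<surd>(1-m\<^sup>2) p, \<surd>(m\<^sup>2-p\<^sup>2))\<close> and
  \<open>(\<surd>(1-s\<^sup>2), \<surd>(s\<^sup>2-p\<^sup>2))\<close>, whose squared norms are
  \<open>m\<^sup>2 (1-p\<^sup>2)\<close> and \<open>1-p\<^sup>2\<close>.\<close>

lemma oval_closure_abs_fst_le:
  assumes "(q, p) \<in> oval_interior \<union> oval"
  shows "\<bar>q\<bar> \<le> m"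
proof -
  define w where "w = q * (1 - p\<^sup>2) - a / 2 * p"
  have p: "\<bar>p\<bar> \<le> m" and w: "w\<^sup>2 \<le> (m\<^sup>2 - p\<^sup>2) * (s\<^sup>2 - p\<^sup>2)"
    using assms by (auto simp: in_oval_iff in_oval_interior_iff w_def)
  define x y where "x = p\<^sup>2 * (1 - m\<^sup>2) * (s\<^sup>2 - p\<^sup>2)" and "y = (m\<^sup>2 - p\<^sup>2) * (1 - s\<^sup>2)"
  have m2: "m\<^sup>2 \<le> 1" and s2: "s\<^sup>2 \<le> 1"
    using m_pos m_less_s s_le_1 by (auto intro: power_le_one)
  have nonneg: "0 \<le> x" "0 \<le> y"
    unfolding x_def y_def using m2 s2 abs_le_m_imp[OF p] by auto
  have "(a * p * w)\<^sup>2 = 4 * (a / 2)\<^sup>2 * p\<^sup>2 * w\<^sup>2"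
    by (simp add: power_mult_distrib power_divide)
  also have "\<dots> \<le> 4 * (a / 2)\<^sup>2 * p\<^sup>2 * ((m\<^sup>2 - p\<^sup>2) * (s\<^sup>2 - p\<^sup>2))"
    using w by (intro mult_left_mono) auto
  also have "\<dots> = 4 * x * y"
    unfolding half_a_squared x_def y_def by algebra
  also have "\<dots> \<le> (x + y)\<^sup>2"
    using zero_le_power2[of "x - y"] by (simp add: power2_eq_square algebra_simps)
  finally have cross: "a * p * w \<le> x + y"
    by (rule power2_le_imp_le) (use nonneg in simp)
  have "(q * (1 - p\<^sup>2))\<^sup>2 = (a / 2 * p + w)\<^sup>2"
    by (simp add: w_def)
  also have "\<dots> = (a / 2)\<^sup>2 * p\<^sup>2 + a * p * w + w\<^sup>2"
    by (simp add: power2_eq_square algebra_simps)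
  also have "\<dots> \<le> (1 - m\<^sup>2) * (1 - s\<^sup>2) * p\<^sup>2 + (x + y) + (m\<^sup>2 - p\<^sup>2) * (s\<^sup>2 - p\<^sup>2)"
    unfolding half_a_squared using cross w by linarith
  also have "\<dots> = (m * (1 - p\<^sup>2))\<^sup>2"
    unfolding x_def y_def by algebra
  finally have "\<bar>q * (1 - p\<^sup>2)\<bar> \<le> \<bar>m * (1 - p\<^sup>2)\<bar>"
    by (simp add: abs_le_square_iff)
  then show ?thesis
    using abs_le_m_imp(3)[OF p] m_pos by (simp add: abs_mult)
qed

lemma bounded_oval_closure: "bounded (oval_interior \<union> oval)"
proof (rule bounded_subset)
  show "bounded (cbox (- m) m \<times> cbox (- m) m)"
    by (intro bounded_Times bounded_cbox)
  show "oval_interior \<union> oval \<subseteq> cbox (- m) m \<times> cbox (- m) m"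
  proof
    fix z
    assume z: "z \<in> oval_interior \<union> oval"
    then have "\<bar>snd z\<bar> \<le> m"
      by (auto simp: oval_interior_def oval_def)
    moreover have "\<bar>fst z\<bar> \<le> m"
      using z oval_closure_abs_fst_le[of "fst z" "snd z"] by simp
    ultimately show "z \<in> cbox (- m) m \<times> cbox (- m) m"
      by (cases z) (auto simp: abs_le_iff)
  qed
qed

lemma compact_oval: "compact oval"
  using bounded_oval_closure closed_oval by (auto simp: compact_eq_bounded_closed)

lemma inside_oval: "inside oval = oval_interior"
proof
  show "oval_interior \<subseteq> inside oval"
    using bounded_oval_closure
    by (intro bounded_open_subset_inside open_oval_interior closed_oval_closure)
      (auto simp: oval_interior_def oval_def)
  show "inside oval \<subseteq> oval_interior"
  proof
    fix z
    assume z: "z \<in> inside oval"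
    obtain q p where zqp: "z = (q, p)" by (cases z)
    show "z \<in> oval_interior"
    proof (rule ccontr)
      assume "z \<notin> oval_interior"
      moreover have "z \<notin> oval"
        using z inside_no_overlap by blast
      ultimately have out: "z \<notin> oval_interior \<union> oval" by blast
      define w where "w x = x * (1 - p\<^sup>2) - a / 2 * p" for x
      \<comment> \<open>In each case one axis-parallel ray from \<open>z\<close> misses the oval:
        vertically away from the strip, or horizontally in the direction in which
        \<open>\<bar>w\<bar>\<close> grows. Points inside the oval have no such ray.\<close>
      consider "m < p" | "p < - m" | "\<bar>p\<bar> \<le> m" "0 \<le> w q" | "\<bar>p\<bar> \<le> m" "w q \<le> 0"
        by linarith
      then show False
      proof cases
        case 1
        obtain t where "0 < t" "z + t *\<^sub>R (0, 1) \<in> oval"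
          using ray_from_inside_meets[OF compact_oval z, of "(0, 1)"] by (auto simp: prod_eq_iff)
        with 1 show False by (auto simp: oval_def zqp)
      next
        case 2
        obtain t where "0 < t" "z + t *\<^sub>R (0, -1) \<in> oval"
          using ray_from_inside_meets[OF compact_oval z, of "(0, -1)"] by (auto simp: prod_eq_iff)
        with 2 show False by (auto simp: oval_def zqp)
      next
        case 3
        obtain t where t: "0 < t" "z + t *\<^sub>R (1, 0) \<in> oval"
          using ray_from_inside_meets[OF compact_oval z, of "(1, 0)"] by (auto simp: prod_eq_iff)
        have "w q \<le> w (q + t)"
          using t abs_le_m_imp(3)[OF 3(1)] by (simp add: w_def)
        then have "(w q)\<^sup>2 \<le> (w (q + t))\<^sup>2"
          using 3 by (intro power_mono) auto
        with 3 t out show False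
          by (auto simp: zqp in_oval_iff in_oval_interior_iff w_def)
      next
        case 4
        obtain t where t: "0 < t" "z + t *\<^sub>R (-1, 0) \<in> oval"
          using ray_from_inside_meets[OF compact_oval z, of "(-1, 0)"] by (auto simp: prod_eq_iff)
        have "w (q - t) \<le> w q"
          using t abs_le_m_imp(3)[OF 4(1)] by (simp add: w_def)
        then have "(w q)\<^sup>2 \<le> (w (q - t))\<^sup>2"
          using 4 by (simp flip: abs_le_square_iff)
        with 4 t out show False
          by (auto simp: zqp in_oval_iff in_oval_interior_iff w_def)
      qed
    qed
  qed
qed

section \<open>Identification of the closed curve with the oval\<close>

text \<open>Along a ray the invariant is \<open>t\<^sup>2 * A - t ^ 4 * b\<close>. A second positive
  solution would force \<open>t\<^sup>2 * b = m\<^sup>2 * s\<^sup>2\<close>, but all coordinates are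
  at most \<open>m\<close> in absolute value, so the left side is at most
  \<open>m ^ 4\<close>.\<close>

lemma oval_ray_unique:
  assumes z: "z \<in> oval" and tz: "t *\<^sub>R z \<in> oval" and "0 < t"
  shows "t = 1"
proof (rule ccontr)
  assume "t \<noteq> 1"
  obtain q p where zqp: "z = (q, p)" by (cases z)
  define A where "A = q\<^sup>2 - a * p * q + p\<^sup>2"
  define b where "b = p\<^sup>2 * q\<^sup>2"
  have 1: "A - b = m\<^sup>2 * s\<^sup>2"
    using z by (simp add: zqp oval_def oct_invariant_def A_def b_def)
  have 2: "t\<^sup>2 * A - t ^ 4 * b = m\<^sup>2 * s\<^sup>2"
    using tz by (simp add: zqp oval_def oct_invariant_def A_def b_def) algebra
  have "(t\<^sup>2 - 1) * (t\<^sup>2 * b - m\<^sup>2 * s\<^sup>2) = 0"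
    using 1 2 by algebra
  moreover have "t\<^sup>2 \<noteq> 1"
    using \<open>0 < t\<close> \<open>t \<noteq> 1\<close> by (auto simp: power2_eq_1_iff)
  ultimately have "m\<^sup>2 * s\<^sup>2 = (t * q) * (t * p) * (q * p)"
    by (simp add: b_def power2_eq_square mult_ac)
  also have "\<dots> \<le> \<bar>t * q\<bar> * \<bar>t * p\<bar> * (\<bar>q\<bar> * \<bar>p\<bar>)"
    by (metis abs_ge_self abs_mult)
  also have "\<dots> \<le> m * m * (m * m)"
    using z tz oval_closure_abs_fst_le[of q p] oval_closure_abs_fst_le[of "t * q" "t * p"] m_pos
    by (intro mult_mono) (auto simp: zqp oval_def)
  also have "\<dots> < m\<^sup>2 * s\<^sup>2"
    using m_pos m_less_s by (simp add: power2_eq_square mult_strict_mono)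
  finally show False by simp
qed

text \<open>For \<open>\<bar>p\<bar>\<close> strictly between \<open>m\<close> and \<open>s\<close>
  the discriminant is negative, whereas on the level it equals a square.\<close>

lemma level_set_gap:
  assumes "oct_invariant a (q, p) = m\<^sup>2 * s\<^sup>2"
  shows "\<bar>p\<bar> \<le> m \<or> s \<le> \<bar>p\<bar>"
proof (rule ccontr)
  assume "\<not> ?thesis"
  then have "m\<^sup>2 < p\<^sup>2" "p\<^sup>2 < s\<^sup>2"
    using m_pos m_less_s abs_le_square_iff[of p m] abs_le_square_iff[of s p] by auto
  then have "(m\<^sup>2 - p\<^sup>2) * (s\<^sup>2 - p\<^sup>2) < 0"
    by (simp add: mult_neg_pos)
  then show False
    using oct_invariant_discriminant[of p q] assms
      zero_le_power2[of "q * (1 - p\<^sup>2) - a / 2 * p"] by simp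
qed

theorem oct_curve_eq_oval:
  assumes "oct_curve a (m\<^sup>2 * s\<^sup>2) C"
  shows "C = oval"
proof -
  obtain \<gamma> where \<gamma>: "simple_path \<gamma>" "path_image \<gamma> = C"
    using assms by (auto simp: oct_curve_def closed_curve_def)
  have C: "compact C" "connected C"
    using \<gamma> connected_path_image compact_path_image simple_path_imp_path by blast+
  have level: "oct_invariant a z = m\<^sup>2 * s\<^sup>2" if "z \<in> C" for z
    using assms that by (auto simp: oct_curve_def)
  have origin: "(0, 0) \<in> inside C"
    using assms by (auto simp: oct_curve_def)
  have meets: "\<exists>t>0. t *\<^sub>R l \<in> C" if "l \<noteq> 0" for l
    using ray_from_inside_meets[OF C(1) origin that] by (metis add_0 zero_prod_def)
  have conn: "connected (snd ` C)"
    using C by (intro connected_continuous_image continuous_intros)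
  \<comment> \<open>A value in the gap that the heights on \<open>C\<close> must avoid, with either
    sign. Since these heights form an interval with negative and positive elements, they stay
    between \<open>- c\<close> and \<open>c\<close>.\<close>
  define c where "c = (m + s) / 2"
  have c: "m < c" "c < s" "0 < c" using m_pos m_less_s by (auto simp: c_def)
  have not_c: "c \<notin> snd ` C" "- c \<notin> snd ` C"
    using level_set_gap level c by fastforce+
  obtain z1 where z1: "z1 \<in> C" "0 < snd z1"
    using meets[of "(0, 1)"] by (auto simp: prod_eq_iff)
  obtain z2 where z2: "z2 \<in> C" "snd z2 < 0"
    using meets[of "(0, -1)"] by (auto simp: prod_eq_iff)
  have bound: "- c < snd z \<and> snd z < c" if "z \<in> C" for z
    using connectedD_interval[OF conn, of "snd z2" "snd z" c]
      connectedD_interval[OF conn, of "snd z" "snd z1" "- c"] that z1 z2 c not_c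
    by fastforce
  have "C \<subseteq> oval"
  proof
    fix z
    assume z: "z \<in> C"
    then show "z \<in> oval"
      using level[OF z] level_set_gap[of "fst z" "snd z"] bound[OF z] c by (auto simp: oval_def)
  qed
  \<comment> \<open>The ray through a point of the oval meets \<open>C\<close>, hence meets the oval
    there, and by uniqueness the two points agree.\<close>
  moreover have "oval \<subseteq> C"
  proof
    fix z
    assume z: "z \<in> oval"
    have "z \<noteq> 0"
      using z m_pos m_less_s by (auto simp: oval_def oct_invariant_def zero_prod_def)
    then obtain t where "0 < t" "t *\<^sub>R z \<in> C"
      using meets by blast
    with z \<open>C \<subseteq> oval\<close> show "z \<in> C"
      using oval_ray_unique[of z t] by auto
  qed
  ultimately show ?thesis by blast
qed

section \<open>Area by horizontal slices\<close>

lemma measure_oval_interior: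
  "measure lebesgue oval_interior
    = integral {- m..m} (\<lambda>p. 2 * sqrt ((m\<^sup>2 - p\<^sup>2) * (s\<^sup>2 - p\<^sup>2)) / (1 - p\<^sup>2))"
proof -
  define D where "D p = (m\<^sup>2 - p\<^sup>2) * (s\<^sup>2 - p\<^sup>2)" for p
  define f where "f p = 2 * sqrt (D p) / (1 - p\<^sup>2)" for p
  have borel: "oval_interior \<in> sets borel"
    by (simp add: open_oval_interior)
  have D_nonneg: "0 \<le> D p" if "p \<in> {- m..m}" for p
    using abs_le_m_imp(1,2)[of p] that by (auto simp: D_def abs_le_iff)
  have f_nonneg: "0 \<le> f p" if "p \<in> {- m..m}" for p
    using abs_le_m_imp(3)[of p] D_nonneg[OF that] that by (auto simp: f_def abs_le_iff)
  have "continuous_on {- m..m} f"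
    unfolding f_def D_def using abs_le_m_imp(3)
    by (intro continuous_intros) (fastforce simp: abs_le_iff)
  then have f_int: "(f has_integral integral {- m..m} f) {- m..m}"
    by (intro integrable_integral integrable_continuous_real)
  \<comment> \<open>Inside the strip the slice is the open interval between the two roots in
    \<open>q\<close>; outside it is empty. Fubini then gives the area.\<close>
  have slice: "emeasure lborel ((\<lambda>q. (q, p)) -` oval_interior) = ennreal (f p) * indicator {- m..m} p" for p
  proof (cases "p \<in> {- m..m}")
    case True
    then have p: "\<bar>p\<bar> \<le> m" by (simp add: abs_le_iff)
    have "(q, p) \<in> oval_interior
        \<longleftrightarrow> q \<in> {(a / 2 * p - sqrt (D p)) / (1 - p\<^sup>2) <..< (a / 2 * p + sqrt (D p)) / (1 - p\<^sup>2)}" for q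
    proof -
      have "(q, p) \<in> oval_interior \<longleftrightarrow> (q * (1 - p\<^sup>2) - a / 2 * p)\<^sup>2 < D p"
        using p by (simp add: in_oval_interior_iff D_def)
      also have "\<dots> \<longleftrightarrow> \<bar>q * (1 - p\<^sup>2) - a / 2 * p\<bar> < sqrt (D p)"
        by (metis real_sqrt_abs real_sqrt_less_iff)
      finally show ?thesis
        using abs_le_m_imp(3)[OF p] by (auto simp: abs_less_iff field_simps)
    qed
    then have "(\<lambda>q. (q, p)) -` oval_interior
        = {(a / 2 * p - sqrt (D p)) / (1 - p\<^sup>2) <..< (a / 2 * p + sqrt (D p)) / (1 - p\<^sup>2)}"
      by blast
    moreover have "(a / 2 * p - sqrt (D p)) / (1 - p\<^sup>2) \<le> (a / 2 * p + sqrt (D p)) / (1 - p\<^sup>2)"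
      using abs_le_m_imp(3)[OF p] D_nonneg[OF True] by (intro divide_right_mono) auto
    moreover have "(a / 2 * p + sqrt (D p)) / (1 - p\<^sup>2) - (a / 2 * p - sqrt (D p)) / (1 - p\<^sup>2) = f p"
      by (simp add: f_def diff_divide_distrib[symmetric])
    ultimately show ?thesis
      using True by simp
  next
    case False
    then have "(\<lambda>q. (q, p)) -` oval_interior = {}"
      by (auto simp: oval_interior_def abs_less_iff)
    with False show ?thesis by simp
  qed
  have "emeasure lebesgue oval_interior = emeasure (lborel \<Otimes>\<^sub>M lborel) oval_interior"
    using borel by (simp add: lborel_prod)
  also have "\<dots> = (\<integral>\<^sup>+p. emeasure lborel ((\<lambda>q. (q, p)) -` oval_interior) \<partial>lborel)"
    using borel by (intro lborel_pair.emeasure_pair_measure_alt2) (simp only: lborel_prod sets_lborel)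
  also have "\<dots> = ennreal (integral {- m..m} f)"
    unfolding slice by (intro nn_integral_has_integral_lebesgue' f_int f_nonneg)
  moreover have "0 \<le> integral {- m..m} f"
    using f_nonneg f_int by (auto intro: integral_nonneg)
  ultimately have "measure lebesgue oval_interior = integral {- m..m} f"
    by (simp add: measure_def)
  then show ?thesis
    by (simp add: f_def[abs_def] D_def)
qed

end

section \<open>Elliptic parametrization\<close>

text \<open>As dn is positive, cn at \<open>\<eta>\<close> carries the sign of \<open>a\<close>;
  leaving the range of \<open>\<eta>\<close> open treats both signs at once.\<close>

locale elliptic_octupole = elliptic_modulus +
  fixes a \<eta> :: real
  assumes modulus_pos: "0 < \<kappa>" and jsn_pos: "0 < jsn \<eta> \<kappa>"
    and a_eq: "a = 2 * jcn \<eta> \<kappa> * jdn \<eta> \<kappa>"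
begin

abbreviation "s \<equiv> jsn \<eta> \<kappa>"
abbreviation "m \<equiv> \<kappa> * s"

sublocale octupole_oval a m s
proof
  have "\<kappa> < 1"
    using modulus_less_1 modulus_pos by (simp add: power_less_one_iff abs_square_less_1)
  then show "m < s"
    using jsn_pos by simp
  show "s \<le> 1"
    by (simp add: jsn_def)
  have "(a / 2)\<^sup>2 = (jcn \<eta> \<kappa>)\<^sup>2 * (jdn \<eta> \<kappa>)\<^sup>2"
    by (simp add: a_eq power_mult_distrib)
  then show "(a / 2)\<^sup>2 = (1 - m\<^sup>2) * (1 - s\<^sup>2)"
    by (simp add: jcn_squared jdn_squared power_mult_distrib)
qed (use modulus_pos jsn_pos in simp)

text \<open>The factor \<open>4 * ellK \<kappa>\<close> scales the period to 1. The first coordinate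
  lags by \<open>\<eta>\<close>, so advancing by \<open>\<eta>\<close> realizes the rule
  \<open>q' = p\<close>.\<close>

definition oval_param :: "real \<Rightarrow> real \<times> real" where
  "oval_param t = (m * jsn (4 * ellK \<kappa> * t - \<eta>) \<kappa>, m * jsn (4 * ellK \<kappa> * t) \<kappa>)"

lemma abs_m_sin_le: "\<bar>m * sin \<theta>\<bar> \<le> m"
  using modulus_pos jsn_pos by (simp add: abs_mult)

text \<open>The denominator in the addition theorem is \<open>1 - p\<^sup>2\<close> for
  \<open>p = m * jsn u \<kappa>\<close>. Clearing it expresses the completed square of
  \<open>in_oval_iff\<close> through cn and dn.\<close>

lemma fst_oval_param_eq:
  "m * jsn (u - \<eta>) \<kappa> * (1 - (m * jsn u \<kappa>)\<^sup>2) - a / 2 * (m * jsn u \<kappa>)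
    = - (m * s * jcn u \<kappa> * jdn u \<kappa>)"
proof -
  have den: "1 - (m * jsn u \<kappa>)\<^sup>2 = 1 - \<kappa>\<^sup>2 * (jsn u \<kappa>)\<^sup>2 * s\<^sup>2"
    by (simp add: power_mult_distrib mult_ac)
  have "jsn (u - \<eta>) \<kappa> * (1 - \<kappa>\<^sup>2 * (jsn u \<kappa>)\<^sup>2 * s\<^sup>2)
      = jsn u \<kappa> * jcn \<eta> \<kappa> * jdn \<eta> \<kappa> - s * jcn u \<kappa> * jdn u \<kappa>"
    using jsn_add_denom_pos[of u \<eta>] unfolding jsn_diff by simp
  then have "m * jsn (u - \<eta>) \<kappa> * (1 - (m * jsn u \<kappa>)\<^sup>2)
      = m * (jsn u \<kappa> * jcn \<eta> \<kappa> * jdn \<eta> \<kappa> - s * jcn u \<kappa> * jdn u \<kappa>)"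
    by (simp only: den mult.assoc[of m])
  then show ?thesis
    by (simp add: a_eq algebra_simps)
qed

lemma discriminant_eq:
  "(m\<^sup>2 - (m * x)\<^sup>2) * (s\<^sup>2 - (m * x)\<^sup>2) = (m * s)\<^sup>2 * ((1 - x\<^sup>2) * (1 - \<kappa>\<^sup>2 * x\<^sup>2))"
  by (simp add: power_mult_distrib algebra_simps)

lemma oval_param_in_oval: "oval_param t \<in> oval"
proof -
  define u where "u = 4 * ellK \<kappa> * t"
  have "\<bar>m * jsn u \<kappa>\<bar> \<le> m"
    using abs_m_sin_le by (simp add: jsn_def[of u])
  moreover have "(m * jsn (u - \<eta>) \<kappa> * (1 - (m * jsn u \<kappa>)\<^sup>2) - a / 2 * (m * jsn u \<kappa>))\<^sup>2
      = (m\<^sup>2 - (m * jsn u \<kappa>)\<^sup>2) * (s\<^sup>2 - (m * jsn u \<kappa>)\<^sup>2)"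
    unfolding fst_oval_param_eq discriminant_eq jcn_squared[symmetric] jdn_squared[symmetric]
    by (simp add: power_mult_distrib)
  ultimately show ?thesis
    by (simp add: oval_param_def in_oval_iff flip: u_def)
qed

lemma oval_subset_range_oval_param: "oval \<subseteq> range oval_param"
proof
  fix z
  assume z: "z \<in> oval"
  obtain q p where zqp: "z = (q, p)" by (cases z)
  have p: "\<bar>p\<bar> \<le> m"
    and w: "(q * (1 - p\<^sup>2) - a / 2 * p)\<^sup>2 = (m\<^sup>2 - p\<^sup>2) * (s\<^sup>2 - p\<^sup>2)"
    using z by (auto simp: zqp in_oval_iff)
  define x where "x = p / m"
  have px: "p = m * x"
    using modulus_pos jsn_pos by (simp add: x_def)
  have "\<bar>x\<bar> \<le> 1"
    using p m_pos by (simp add: x_def abs_divide)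
  then have "x\<^sup>2 \<le> 1"
    by (simp add: abs_square_le_1)
  then have "\<kappa>\<^sup>2 * x\<^sup>2 \<le> \<kappa>\<^sup>2"
    by (simp add: mult_left_le)
  then have d_pos: "0 < 1 - \<kappa>\<^sup>2 * x\<^sup>2"
    using modulus_less_1 by linarith
  define d where "d = sqrt (1 - \<kappa>\<^sup>2 * x\<^sup>2)"
  have d: "0 < d" "d\<^sup>2 = 1 - \<kappa>\<^sup>2 * x\<^sup>2"
    using d_pos by (auto simp: d_def)
  \<comment> \<open>By \<open>fst_oval_param_eq\<close> this is the only possible value of cn. The
    equation of the oval puts \<open>(c, x)\<close> on the unit circle, which yields the
    amplitude.\<close>
  define c where "c = - (q * (1 - p\<^sup>2) - a / 2 * p) / (m * s * d)"
  have cd: "m * s * c * d = - (q * (1 - p\<^sup>2) - a / 2 * p)"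
    using modulus_pos jsn_pos d(1) by (simp add: c_def)
  have "c\<^sup>2 = (q * (1 - p\<^sup>2) - a / 2 * p)\<^sup>2 / (m * s * d)\<^sup>2"
    by (simp only: c_def power_divide power2_minus)
  also have "\<dots> = ((m * s)\<^sup>2 * ((1 - x\<^sup>2) * d\<^sup>2)) / ((m * s)\<^sup>2 * d\<^sup>2)"
    unfolding w unfolding px discriminant_eq by (simp only: power_mult_distrib d(2))
  also have "\<dots> = 1 - x\<^sup>2"
    using modulus_pos jsn_pos d(1) by simp
  finally have "c\<^sup>2 + x\<^sup>2 = 1" by simp
  then obtain \<phi> where \<phi>: "c = cos \<phi>" "x = sin \<phi>"
    using sincos_total_2pi by metis
  define u where "u = ellF \<phi> \<kappa>"
  have u: "jsn u \<kappa> = x" "jcn u \<kappa> = c" "jdn u \<kappa> = d"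
    by (auto simp: u_def jsn_def jcn_def jdn_def d_def \<phi>)
  have "m * jsn (u - \<eta>) \<kappa> * (1 - p\<^sup>2) = q * (1 - p\<^sup>2)"
    using fst_oval_param_eq[of u] cd unfolding u px[symmetric] by linarith
  then have "m * jsn (u - \<eta>) \<kappa> = q"
    using abs_le_m_imp(3)[OF p] by simp
  then have "oval_param (u / (4 * ellK \<kappa>)) = z"
    using ellK_pos by (simp add: oval_param_def zqp u px)
  then show "z \<in> range oval_param" by blast
qed

text \<open>The second coordinate fixes sn, hence dn; the first then fixes cn. Sine and cosine
  determine the amplitude modulo \<open>2 * pi\<close>, and over one period it stays in a half-open
  interval of that length.\<close>

lemma inj_on_oval_param: "inj_on oval_param {0..<1}"
proof (rule inj_onI)
  fix t t'
  assume t: "t \<in> {0..<1}" and t': "t' \<in> {0..<1}" and eq: "oval_param t = oval_param t'"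
  define u u' where "u = 4 * ellK \<kappa> * t" and "u' = 4 * ellK \<kappa> * t'"
  have sn: "jsn u \<kappa> = jsn u' \<kappa>"
    using eq m_pos modulus_pos jsn_pos by (simp add: oval_param_def u_def u'_def)
  then have dn: "jdn u \<kappa> = jdn u' \<kappa>"
    by (simp add: jdn_def)
  have fst: "m * jsn (u - \<eta>) \<kappa> = m * jsn (u' - \<eta>) \<kappa>"
    using eq by (simp add: oval_param_def u_def u'_def)
  have "- (m * s * jcn u \<kappa> * jdn u \<kappa>) = - (m * s * jcn u' \<kappa> * jdn u' \<kappa>)"
    unfolding fst_oval_param_eq[symmetric] sn fst ..
  then have cn: "jcn u \<kappa> = jcn u' \<kappa>"
    using modulus_pos jsn_pos jdn_pos[of u'] by (simp add: dn)
  have am: "0 \<le> jam (4 * ellK \<kappa> * r) \<kappa>" "jam (4 * ellK \<kappa> * r) \<kappa> < 2 * pi" if "r \<in> {0..<1}" for r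
    using that ellK_pos jam_0 jam_period[of 0]
      strict_mono_less_eq[OF jam_strict_mono, of 0 "4 * ellK \<kappa> * r"]
      strict_mono_less[OF jam_strict_mono, of "4 * ellK \<kappa> * r" "4 * ellK \<kappa>"]
    by auto
  obtain n :: int where n: "jam u \<kappa> = jam u' \<kappa> + 2 * pi * n"
    using sn cn unfolding jsn_def jcn_def by (metis sin_cos_eq_iff)
  have "\<bar>jam u \<kappa> - jam u' \<kappa>\<bar> < 2 * pi"
    using am[OF t] am[OF t'] by (simp add: u_def u'_def abs_less_iff)
  then have "\<bar>real_of_int n\<bar> < 1"
    by (simp add: n abs_mult)
  then have "n = 0" by linarith
  with n have "u = u'"
    using strict_mono_eq[OF jam_strict_mono] by simp
  then show "t = t'"
    using ellK_pos by (simp add: u_def u'_def)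
qed

lemma circle_param_oval_param: "circle_param oval_param oval"
proof -
  have jsn_cont: "continuous_on UNIV (\<lambda>u. jsn u \<kappa>)"
    using DERIV_jsn DERIV_isCont continuous_at_imp_continuous_on by blast
  have "continuous_on UNIV oval_param"
    unfolding oval_param_def by (intro continuous_intros continuous_on_compose2[OF jsn_cont]) auto
  moreover have "oval_param (t + 1) = oval_param t" for t
    using jsn_period[of "4 * ellK \<kappa> * t"] jsn_period[of "4 * ellK \<kappa> * t - \<eta>"]
    by (simp add: oval_param_def algebra_simps)
  ultimately show ?thesis
    using inj_on_oval_param oval_param_in_oval oval_subset_range_oval_param by (auto simp: circle_param_def)
qed

lemma circle_lift_oval_param: "circle_lift oval_param (oct_map a) (\<lambda>t. t + \<eta> / (4 * ellK \<kappa>))"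
proof -
  have "oval_param (t + \<eta> / (4 * ellK \<kappa>)) = oct_map a (oval_param t)" for t
  proof -
    define u where "u = 4 * ellK \<kappa> * t"
    let ?den = "1 - (m * jsn u \<kappa>)\<^sup>2"
    have shift: "4 * ellK \<kappa> * (t + \<eta> / (4 * ellK \<kappa>)) = u + \<eta>"
      using ellK_pos by (simp add: u_def field_simps)
    have den: "1 - \<kappa>\<^sup>2 * (jsn u \<kappa>)\<^sup>2 * s\<^sup>2 = ?den"
      by (simp add: power_mult_distrib mult_ac)
    \<comment> \<open>The terms with cn and dn at \<open>u\<close> cancel in the sum, and
      \<open>a_eq\<close> turns the rest into the force term of the map.\<close>
    have "jsn (u + \<eta>) \<kappa> + jsn (u - \<eta>) \<kappa> = a * jsn u \<kappa> / ?den"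
      unfolding jsn_add jsn_diff den by (simp add: a_eq add_divide_distrib[symmetric] mult_ac)
    then have "jsn (u + \<eta>) \<kappa> = a * jsn u \<kappa> / ?den - jsn (u - \<eta>) \<kappa>"
      by linarith
    then have "m * jsn (u + \<eta>) \<kappa> = - (m * jsn (u - \<eta>) \<kappa>) + a * (m * jsn u \<kappa>) / ?den"
      by (simp add: right_diff_distrib)
    then show ?thesis
      by (simp add: oval_param_def oct_map_def shift flip: u_def)
  qed
  then show ?thesis
    by (auto simp: circle_lift_def strict_mono_def intro!: continuous_intros)
qed

lemma has_rotation_number_oval:
  assumes "0 \<le> \<eta>" and "\<eta> \<le> 2 * ellK \<kappa>"
  shows "has_rotation_number (oct_map a) oval (\<eta> / (4 * ellK \<kappa>))"
proof -
  define \<nu> where "\<nu> = \<eta> / (4 * ellK \<kappa>)"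
  have iter: "((\<lambda>t. t + \<nu>) ^^ n) t = t + real n * \<nu>" for n t
    by (induction n) (auto simp: algebra_simps)
  have "(\<lambda>n. (((\<lambda>t. t + \<nu>) ^^ n) t - t) / real n) \<longlonglongrightarrow> \<nu>" for t
  proof (rule tendsto_eventually)
    \<comment> \<open>Equality holds only for positive \<open>n\<close>: at \<open>n = 0\<close> the
      quotient is 0 by the convention for division by zero.\<close>
    show "\<forall>\<^sub>F n in sequentially. (((\<lambda>t. t + \<nu>) ^^ n) t - t) / real n = \<nu>"
      using eventually_gt_at_top[of 0] by eventually_elim (simp add: iter)
  qed
  moreover have "0 \<le> \<nu>" "\<nu> \<le> 1 / 2"
    using assms ellK_pos by (auto simp: \<nu>_def field_simps)
  ultimately show ?thesis
    using circle_param_oval_param circle_lift_oval_param unfolding has_rotation_number_def \<nu>_def by blast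
qed

section \<open>The action in terms of complete elliptic integrals\<close>

text \<open>Polynomial division of \<open>(1-x) (1-\<kappa>\<^sup>2x)\<close> by \<open>1-m\<^sup>2x\<close>, where
  \<open>x = sin\<^sup>2 \<theta>\<close>.\<close>

lemma area_integrand_eq:
  "(cos \<theta>)\<^sup>2 * \<Delta> \<theta> / (1 - (m * sin \<theta>)\<^sup>2)
    = (s\<^sup>2 * \<Delta> \<theta> - (jdn \<eta> \<kappa>)\<^sup>2 * (1 / \<Delta> \<theta>)
        + (jdn \<eta> \<kappa>)\<^sup>2 * (jcn \<eta> \<kappa>)\<^sup>2 * (1 / ((1 - m\<^sup>2 * (sin \<theta>)\<^sup>2) * \<Delta> \<theta>)))
      / (\<kappa>\<^sup>2 * s ^ 4)"
proof -
  define x where "x = (sin \<theta>)\<^sup>2"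
  define D where "D = \<Delta> \<theta>"
  define N where "N = 1 - m\<^sup>2 * x"
  have D: "0 < D" "D\<^sup>2 = 1 - \<kappa>\<^sup>2 * x"
    using \<Delta>_pos \<Delta>_squared by (auto simp: D_def x_def)
  have N: "0 < N"
    using abs_le_m_imp(3)[OF abs_m_sin_le, of \<theta>] by (simp add: N_def x_def power_mult_distrib)
  have key: "\<kappa>\<^sup>2 * s ^ 4 * ((1 - x) * D\<^sup>2)
      = s\<^sup>2 * D\<^sup>2 * N - (jdn \<eta> \<kappa>)\<^sup>2 * N + (jdn \<eta> \<kappa>)\<^sup>2 * (jcn \<eta> \<kappa>)\<^sup>2"
    unfolding D(2) N_def jdn_squared jcn_squared by algebra
  have "(s\<^sup>2 * D - (jdn \<eta> \<kappa>)\<^sup>2 * (1 / D) + (jdn \<eta> \<kappa>)\<^sup>2 * (jcn \<eta> \<kappa>)\<^sup>2 * (1 / (N * D)))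
      = (s\<^sup>2 * D\<^sup>2 * N - (jdn \<eta> \<kappa>)\<^sup>2 * N + (jdn \<eta> \<kappa>)\<^sup>2 * (jcn \<eta> \<kappa>)\<^sup>2) / (N * D)"
    using N D(1) by (simp add: field_simps power2_eq_square)
  also have "\<dots> = \<kappa>\<^sup>2 * s ^ 4 * ((1 - x) * D / N)"
    unfolding key[symmetric] using N D(1) by (simp add: power2_eq_square)
  finally show ?thesis
    using modulus_pos jsn_pos by (simp add: N_def D_def x_def power_mult_distrib cos_squared_eq)
qed

lemma area_integral:
  "integral {0..pi / 2} (\<lambda>\<theta>. (cos \<theta>)\<^sup>2 * \<Delta> \<theta> / (1 - (m * sin \<theta>)\<^sup>2))
    = (s\<^sup>2 * ellE \<kappa> - (jdn \<eta> \<kappa>)\<^sup>2 * ellK \<kappa>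
        + (jdn \<eta> \<kappa>)\<^sup>2 * (jcn \<eta> \<kappa>)\<^sup>2 * ellPi (m\<^sup>2) \<kappa>) / (\<kappa>\<^sup>2 * s ^ 4)"
proof -
  have nz: "\<Delta> \<theta> \<noteq> 0" for \<theta>
    using \<Delta>_pos[of \<theta>] by simp
  have nz': "1 - m\<^sup>2 * (sin \<theta>)\<^sup>2 \<noteq> 0" for \<theta>
    using abs_le_m_imp(3)[OF abs_m_sin_le, of \<theta>] by (simp add: power_mult_distrib)
  have "(\<Delta> has_integral ellE \<kappa>) {0..pi / 2}"
    unfolding ellE_def \<Delta>_def[symmetric]
    by (intro integrable_integral integrable_continuous_real continuous_\<Delta>)
  moreover have "((\<lambda>\<theta>. 1 / \<Delta> \<theta>) has_integral ellK \<kappa>) {0..pi / 2}"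
    unfolding ellK_def \<Delta>_def[symmetric] using nz
    by (intro integrable_integral integrable_continuous_real continuous_intros continuous_\<Delta>) auto
  moreover have "((\<lambda>\<theta>. 1 / ((1 - m\<^sup>2 * (sin \<theta>)\<^sup>2) * \<Delta> \<theta>)) has_integral ellPi (m\<^sup>2) \<kappa>) {0..pi / 2}"
    unfolding ellPi_def \<Delta>_def[symmetric] using nz nz'
    by (intro integrable_integral integrable_continuous_real continuous_intros continuous_\<Delta>) auto
  ultimately show ?thesis
    unfolding area_integrand_eq
    by (intro integral_unique has_integral_divide has_integral_add has_integral_diff has_integral_mult_right)
qed

text \<open>Under \<open>p = m * sin \<theta>\<close> the square root becomes
  \<open>m * s * cos \<theta> * \<Delta> \<theta>\<close>, as the cosine is nonnegative on the
  range. The integrand is even in \<open>\<theta>\<close>, which gives the second factor 2.\<close>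

lemma measure_oval_interior_eq_area_integral:
  "measure lebesgue oval_interior
    = 4 * m\<^sup>2 * s * integral {0..pi / 2} (\<lambda>\<theta>. (cos \<theta>)\<^sup>2 * \<Delta> \<theta> / (1 - (m * sin \<theta>)\<^sup>2))"
proof -
  define f where "f p = 2 * sqrt ((m\<^sup>2 - p\<^sup>2) * (s\<^sup>2 - p\<^sup>2)) / (1 - p\<^sup>2)" for p
  define g where "g \<theta> = (cos \<theta>)\<^sup>2 * \<Delta> \<theta> / (1 - (m * sin \<theta>)\<^sup>2)" for \<theta>
  have f_cont: "continuous_on {- m..m} f"
    unfolding f_def using abs_le_m_imp(3)
    by (intro continuous_intros) (fastforce simp: abs_le_iff)
  have "((\<lambda>\<theta>. (m * cos \<theta>) *\<^sub>R f (m * sin \<theta>)) has_integral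
      integral {m * sin (- (pi / 2))..m * sin (pi / 2)} f) {- (pi / 2)..pi / 2}"
  proof (rule has_integral_substitution[where c = "- m" and d = m])
    show "(\<lambda>\<theta>. m * sin \<theta>) ` {- (pi / 2)..pi / 2} \<subseteq> {- m..m}"
      using abs_m_sin_le by (intro image_subsetI) (simp add: abs_le_iff minus_le_iff)
    show "((\<lambda>\<theta>. m * sin \<theta>) has_real_derivative m * cos x) (at x within {- (pi / 2)..pi / 2})" for x
      by (auto intro!: derivative_eq_intros)
  qed (use m_pos f_cont in auto)
  then have "((\<lambda>\<theta>. (m * cos \<theta>) *\<^sub>R f (m * sin \<theta>)) has_integral integral {- m..m} f) {- (pi / 2)..pi / 2}"
    by simp
  then have "((\<lambda>\<theta>. 2 * m\<^sup>2 * s * g \<theta>) has_integral integral {- m..m} f) {- (pi / 2)..pi / 2}"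
  proof (rule has_integral_eq[rotated])
    show "(m * cos \<theta>) *\<^sub>R f (m * sin \<theta>) = 2 * m\<^sup>2 * s * g \<theta>" if "\<theta> \<in> {- (pi / 2)..pi / 2}" for \<theta>
    proof -
      have "0 \<le> m * s * cos \<theta> * \<Delta> \<theta>"
        using that modulus_pos jsn_pos \<Delta>_pos[of \<theta>] cos_ge_zero[of \<theta>] by simp
      moreover have "(m\<^sup>2 - (m * sin \<theta>)\<^sup>2) * (s\<^sup>2 - (m * sin \<theta>)\<^sup>2) = (m * s * cos \<theta> * \<Delta> \<theta>)\<^sup>2"
        unfolding discriminant_eq by (simp only: power_mult_distrib \<Delta>_squared cos_squared_eq mult.assoc)
      ultimately have "sqrt ((m\<^sup>2 - (m * sin \<theta>)\<^sup>2) * (s\<^sup>2 - (m * sin \<theta>)\<^sup>2)) = m * s * cos \<theta> * \<Delta> \<theta>"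
        by (simp only: real_sqrt_abs abs_of_nonneg)
      then show ?thesis
        unfolding f_def g_def by (simp add: power2_eq_square)
    qed
  qed
  then have "integral {- m..m} f = integral {- (pi / 2)..pi / 2} (\<lambda>\<theta>. 2 * m\<^sup>2 * s * g \<theta>)"
    by (rule integral_unique[symmetric])
  also have "\<dots> = 2 * m\<^sup>2 * s * integral {- (pi / 2)..pi / 2} g"
    by (rule Henstock_Kurzweil_Integration.integral_mult_right)
  also have "integral {- (pi / 2)..pi / 2} g = integral {- (pi / 2)..0} g + integral {0..pi / 2} g"
  proof -
    have "1 - (m * sin \<theta>)\<^sup>2 \<noteq> 0" for \<theta>
      using abs_le_m_imp(3)[OF abs_m_sin_le, of \<theta>] by linarith
    then have "continuous_on {- (pi / 2)..pi / 2} g"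
      unfolding g_def by (intro continuous_intros continuous_\<Delta>) auto
    then show ?thesis
      by (intro Henstock_Kurzweil_Integration.integral_combine[symmetric] integrable_continuous_real) auto
  qed
  also have "integral {- (pi / 2)..0} g = integral {0..pi / 2} g"
  proof -
    have "(\<lambda>\<theta>. g (- \<theta>)) = g"
      by (simp add: g_def \<Delta>_def fun_eq_iff)
    then show ?thesis
      using Henstock_Kurzweil_Integration.integral_reflect_real[of "pi / 2" 0 g] by simp
  qed
  finally show ?thesis
    unfolding measure_oval_interior f_def[symmetric] g_def[symmetric] by simp
qed

lemma action_oval:
  "action oval = 2 / pi * (((jsd \<eta> \<kappa>)\<^sup>2 * ellE \<kappa> - ellK \<kappa>
                 + (jcn \<eta> \<kappa>)\<^sup>2 * ellPi (\<kappa>\<^sup>2 * s\<^sup>2) \<kappa>)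
                / (jsd \<eta> \<kappa> * jnd \<eta> \<kappa>))"
proof -
  define d where "d = jdn \<eta> \<kappa>"
  have "0 < d" by (simp add: d_def jdn_pos)
  \<comment> \<open>The prefactor reduces to \<open>2 / (pi * s)\<close>; moving
    \<open>d\<^sup>2\<close> out of the bracket produces sd and the denominator
    \<open>s / d\<^sup>2\<close>, which is sd times nd.\<close>
  have eq: "4 * m\<^sup>2 * s * ((s\<^sup>2 * E - d\<^sup>2 * K + d\<^sup>2 * c * P) / (\<kappa>\<^sup>2 * s ^ 4)) / (2 * pi)
      = 2 / pi * (((s / d)\<^sup>2 * E - K + c * P) / (s / d * (1 / d)))" for E K c P
    using \<open>0 < d\<close> modulus_pos jsn_pos
    by (simp add: field_simps power2_eq_square power4_eq_xxxx)
  have "measure lebesgue oval_interior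
      = 4 * m\<^sup>2 * s * ((s\<^sup>2 * ellE \<kappa> - d\<^sup>2 * ellK \<kappa> + d\<^sup>2 * (jcn \<eta> \<kappa>)\<^sup>2 * ellPi (m\<^sup>2) \<kappa>) / (\<kappa>\<^sup>2 * s ^ 4))"
    unfolding measure_oval_interior_eq_area_integral area_integral d_def ..
  then show ?thesis
    using eq[of "ellE \<kappa>" "ellK \<kappa>" "(jcn \<eta> \<kappa>)\<^sup>2" "ellPi (m\<^sup>2) \<kappa>"]
    by (simp only: action_def inside_oval jsd_def jnd_def d_def power_mult_distrib)
qed

end

section \<open>Matching the elliptic data with \<open>a\<close> and \<open>k\<close>\<close>

theorem mainTheorem5:
  fixes a k B \<kappa> \<eta>\<^sub>p :: real and C :: "(real \<times> real) set"
  assumes "-2 < a" and "a < 2"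
    and "0 < k" and "k < (\<bar>a / 2\<bar> - 1)\<^sup>2"
    and "oct_curve a k C"
    and "B = (1 - (a / 2)\<^sup>2 + k) / sqrt k"
    and "\<kappa> = (B - sqrt (B\<^sup>2 - 4)) / 2"
    and "0 < \<eta>\<^sub>p" and "\<eta>\<^sub>p \<le> ellK \<kappa>"
    and "1 / jsn \<eta>\<^sub>p \<kappa> = sqrt \<kappa> / root 4 k"
  shows "action C =
      2 / pi * (((jsd \<eta>\<^sub>p \<kappa>)\<^sup>2 * ellE \<kappa> - ellK \<kappa>
                 + (jcn \<eta>\<^sub>p \<kappa>)\<^sup>2 * ellPi (\<kappa>\<^sup>2 * (jsn \<eta>\<^sub>p \<kappa>)\<^sup>2) \<kappa>)
                / (jsd \<eta>\<^sub>p \<kappa> * jnd \<eta>\<^sub>p \<kappa>))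
    \<and> has_rotation_number (oct_map a) C
        ((if a < 0 then 2 * ellK \<kappa> - \<eta>\<^sub>p else \<eta>\<^sub>p) / (4 * ellK \<kappa>))"
proof -
  define r where "r = sqrt k"
  have r: "0 < r" "k = r\<^sup>2"
    using \<open>0 < k\<close> by (auto simp: r_def)
  have "\<bar>r\<bar> < \<bar>\<bar>a / 2\<bar> - 1\<bar>"
    using \<open>k < _\<close> abs_le_square_iff[of "\<bar>a / 2\<bar> - 1" r] by (simp add: r not_le[symmetric])
  then have "\<bar>a / 2\<bar> < 1 - r"
    using \<open>-2 < a\<close> \<open>a < 2\<close> \<open>0 < r\<close> by (simp add: abs_if split: if_splits)
  then have "(a / 2)\<^sup>2 < (1 - r)\<^sup>2"
    by (metis abs_ge_zero power2_abs power_strict_mono zero_less_numeral)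
  have Br: "B * r = 1 - (a / 2)\<^sup>2 + r\<^sup>2"
    using assms(6) r by (simp flip: r_def)
  \<comment> \<open>After multiplication by \<open>r\<close>, the bound \<open>2 < B\<close> is just
    \<open>(a / 2)\<^sup>2 < (1 - r)\<^sup>2\<close>, that is, the upper bound on
    \<open>k\<close>.\<close>
  then have "2 * r < B * r"
    using \<open>(a / 2)\<^sup>2 < (1 - r)\<^sup>2\<close> by (simp add: power2_diff)
  then have "2 < B"
    using \<open>0 < r\<close> by simp
  define R where "R = sqrt (B\<^sup>2 - 4)"
  have "4 < B\<^sup>2"
    using power_strict_mono[OF \<open>2 < B\<close>, of 2] by simp
  then have R: "0 < R" "R\<^sup>2 = B\<^sup>2 - 4"
    by (auto simp: R_def)
  have \<kappa>R: "2 * \<kappa> = B - R"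
    using assms(7) by (simp add: R_def)
  \<comment> \<open>\<open>\<kappa>\<close> is the smaller root of
    \<open>x\<^sup>2 - B * x + 1\<close>; the following bounds on \<open>R\<close> place it strictly
    between 0 and 1.\<close>
  have quad: "\<kappa>\<^sup>2 + 1 = B * \<kappa>"
  proof -
    have "(2 * \<kappa>)\<^sup>2 + 4 = 2 * B * (2 * \<kappa>)"
      unfolding \<kappa>R using R(2) by (simp add: power2_eq_square algebra_simps)
    then show ?thesis by (simp add: power_mult_distrib)
  qed
  have "R < B"
    using R \<open>2 < B\<close> by (intro power2_less_imp_less[of R B]) auto
  then have "0 < \<kappa>"
    using \<kappa>R by simp
  have "B - 2 < R"
  proof (rule power2_less_imp_less)
    show "(B - 2)\<^sup>2 < R\<^sup>2"
      unfolding R(2) using \<open>2 < B\<close> by (simp add: power2_diff)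
  qed (use R in simp)
  then have "\<kappa> < 1"
    using \<kappa>R by simp
  interpret elliptic_modulus \<kappa>
    by standard (use \<open>0 < \<kappa>\<close> \<open>\<kappa> < 1\<close> in \<open>simp add: power_less_one_iff\<close>)
  define s where "s = jsn \<eta>\<^sub>p \<kappa>"
  have root4: "root 4 k = sqrt r"
    using real_root_mult_exp[of 2 2 k] by (simp add: r_def sqrt_def)
  have s: "s = sqrt r / sqrt \<kappa>"
    using assms(10) by (metis root4 s_def inverse_divide inverse_eq_divide inverse_inverse_eq)
  have s_pos: "0 < s"
    using s r \<open>0 < \<kappa>\<close> by simp
  \<comment> \<open>This is the defining equation of \<open>\<eta>\<^sub>p\<close>, squared; it says
    that the level is \<open>m\<^sup>2 * s\<^sup>2\<close> with
    \<open>m = \<kappa> * s\<close>.\<close>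
  have s2: "\<kappa> * s\<^sup>2 = r"
    using s r \<open>0 < \<kappa>\<close> by (simp add: power_divide)
  have k_eq: "k = (\<kappa> * s)\<^sup>2 * s\<^sup>2"
    using r s2 by (metis mult.assoc power2_eq_square power_mult_distrib)
  have "jcn \<eta>\<^sub>p \<kappa> \<ge> 0"
  proof -
    have "0 \<le> jam \<eta>\<^sub>p \<kappa>" "jam \<eta>\<^sub>p \<kappa> \<le> pi / 2"
      using strict_mono_less_eq[OF jam_strict_mono, of 0 \<eta>\<^sub>p] jam_0 \<open>0 < \<eta>\<^sub>p\<close>
        strict_mono_less_eq[OF jam_strict_mono, of \<eta>\<^sub>p "ellK \<kappa>"] jam_ellK \<open>\<eta>\<^sub>p \<le> _\<close> by auto
    then show ?thesis
      unfolding jcn_def by (intro cos_ge_zero) auto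
  qed
  \<comment> \<open>Expanding \<open>(1 - s\<^sup>2) * (1 - \<kappa>\<^sup>2 * s\<^sup>2)\<close>
    with \<open>quad\<close> and \<open>s2\<close> gives \<open>1 - B * r + r\<^sup>2\<close>, which
    is \<open>(a / 2)\<^sup>2\<close> by the choice of \<open>B\<close>.\<close>
  moreover have "(a / 2)\<^sup>2 = (jcn \<eta>\<^sub>p \<kappa> * jdn \<eta>\<^sub>p \<kappa>)\<^sup>2"
  proof -
    have "(jcn \<eta>\<^sub>p \<kappa> * jdn \<eta>\<^sub>p \<kappa>)\<^sup>2 = 1 - s\<^sup>2 * (\<kappa>\<^sup>2 + 1) + (\<kappa> * s\<^sup>2)\<^sup>2"
      unfolding power_mult_distrib jcn_squared jdn_squared s_def[symmetric] by algebra
    also have "\<dots> = 1 - B * (\<kappa> * s\<^sup>2) + (\<kappa> * s\<^sup>2)\<^sup>2"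
      unfolding quad by simp
    finally show ?thesis
      using Br by (simp add: s2)
  qed
  ultimately have abs_a: "\<bar>a / 2\<bar> = jcn \<eta>\<^sub>p \<kappa> * jdn \<eta>\<^sub>p \<kappa>"
    using jdn_pos[of \<eta>\<^sub>p] by (metis abs_of_nonneg mult_nonneg_nonneg less_imp_le power2_eq_iff abs_eq_iff)
  \<comment> \<open>The reflection at \<open>ellK \<kappa>\<close> keeps sn and dn and negates cn,
    so it supplies the sign of a negative \<open>a\<close>. The action formula involves cn only
    squared and is unchanged.\<close>
  define \<eta> where "\<eta> = (if a < 0 then 2 * ellK \<kappa> - \<eta>\<^sub>p else \<eta>\<^sub>p)"
  have \<eta>: "jsn \<eta> \<kappa> = s" "jdn \<eta> \<kappa> = jdn \<eta>\<^sub>p \<kappa>" "(jcn \<eta> \<kappa>)\<^sup>2 = (jcn \<eta>\<^sub>p \<kappa>)\<^sup>2"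
    by (auto simp: \<eta>_def s_def jsn_reflect jdn_reflect jcn_reflect)
  interpret elliptic_octupole \<kappa> a \<eta>
  proof
    show "a = 2 * jcn \<eta> \<kappa> * jdn \<eta> \<kappa>"
      using abs_a by (auto simp: \<eta>_def jdn_reflect jcn_reflect)
  qed (use \<open>0 < \<kappa>\<close> s_pos \<eta> in auto)
  have C: "C = oval"
    using assms(5) oct_curve_eq_oval by (simp add: k_eq \<eta>(1))
  have "0 \<le> \<eta>" "\<eta> \<le> 2 * ellK \<kappa>"
    using \<open>0 < \<eta>\<^sub>p\<close> \<open>\<eta>\<^sub>p \<le> ellK \<kappa>\<close> by (auto simp: \<eta>_def)
  then show ?thesis
    using action_oval has_rotation_number_oval
    unfolding C \<eta>_def[symmetric] jsd_def jnd_def \<eta> s_def by simp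
qed

end
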